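(* Let $(X,d)$ be a complete metric space and let $T:X\to P(X)$ be such that $SFix(T)\neq\emptyset$. Suppose there exist $\alpha,\beta,\gamma\ge 0$ with $\alpha+\beta+\gamma<1$ such that $$H(T(x),T(y))\le \alpha\, d(x,y)+\beta\, D(x,T(y))+\gamma\, D(y,T(x))\quad\text{for all } x,y\in X.$$ Then the strict fixed point problem $T(x)=\{x\}$ is Ulam-Hyers stable.
   Context: For a metric space $(X,d)$, $P(X)$ is the family of all nonempty subsets of $X$. For $T:X\to P(X)$, $SFix(T)=\{x\in X: T(x)=\{x\}\}$. For $A,B\in P(X)$: $D(A,B)=\inf\{d(a,b):a\in A,b\in B\}$, with $D(x,B):=D(\{x\},B)$; $e(A,B)=\sup\{D(a,B):a\in A\}\in[0,+\infty]$; $H(A,B)=\max\{e(A,B),e(B,A)\}\in[0,+\infty]$. The strict fixed point problem $T(x)=\{x\}$ is Ulam-Hyers stable if there exists $c>0$ such that, for every $\varepsilon>0$ and every $y^*\in X$ with $D(y^*,T(y^* ))\le\varepsilon$, there exists $x^*\in SFix(T)$ with $d(y^*,x^* )\le c\,\varepsilon$. *)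

theory Defs
  imports "HOL-Analysis.Analysis"
begin

text \<open>
  The gap $D(A,B)$ is the library's \<^const>\<open>setdist\<close>, with $D(x,B)$ rendered as
  \<^term>\<open>setdist {x} B\<close>. For nonempty sets it is the infimum of the distances; it is
  used only for such sets, since the values of $T$ are required to be nonempty.
\<close>

definition excess :: "'a::metric_space set \<Rightarrow> 'a set \<Rightarrow> ennreal" where
  "excess A B = (SUP a\<in>A. ennreal (setdist {a} B))"

definition pompeiu_hausdorff :: "'a::metric_space set \<Rightarrow> 'a set \<Rightarrow> ennreal" where
  "pompeiu_hausdorff A B = max (excess A B) (excess B A)"

definition SFix :: "('a \<Rightarrow> 'a set) \<Rightarrow> 'a set" where
  "SFix T = {x. T x = {x}}"

definition strict_fp_ulam_hyers_stable :: "('a::metric_space \<Rightarrow> 'a set) \<Rightarrow> bool" where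
  "strict_fp_ulam_hyers_stable T \<longleftrightarrow>
    (\<exists>c>0. \<forall>\<epsilon>>0. \<forall>y. setdist {y} (T y) \<le> \<epsilon> \<longrightarrow>
      (\<exists>x\<in>SFix T. dist y x \<le> c * \<epsilon>))"

end

theory Submission
  imports Defs
begin

text \<open>
  At a strict fixed point \<open>z\<close> the set \<open>T z\<close> is the singleton \<open>{z}\<close>, so the Hausdorff functional
  between \<open>T y\<close> and \<open>T z\<close> dominates the distance from \<open>z\<close> to \<^emph>\<open>every\<close> point \<open>b\<close> of \<open>T y\<close>, not
  just to a nearest one. In the contraction condition for the pair \<open>(y, z)\<close>, the term
  \<open>setdist {y} (T z)\<close> is \<open>dist y z\<close>, and \<open>setdist {z} (T y)\<close> is at most \<open>dist z b\<close>, which can be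
  absorbed on the left because \<open>\<gamma> < 1\<close>. Hence \<open>T\<close> moves \<open>y\<close> closer to \<open>z\<close>: each
  \<open>b \<in> T y\<close> satisfies \<open>dist b z \<le> k * dist y z\<close> with \<open>k = (\<alpha> + \<beta>) / (1 - \<gamma>)\<close>, and \<open>k < 1\<close> is exactly
  \<open>\<alpha> + \<beta> + \<gamma> < 1\<close>.

  The triangle inequality through \<open>b\<close> then gives \<open>(1 - k) * dist y z \<le> dist y b\<close>; passing to the
  infimum over \<open>b\<close> bounds \<open>dist y z\<close> by \<open>1 / (1 - k)\<close> times the distance from \<open>y\<close> to \<open>T y\<close>. One
  strict fixed point therefore serves as the witness for all approximate solutions \<open>y\<close>.
\<close>

lemma setdist_le_pompeiu_hausdorff:
  assumes "a \<in> A"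
  shows "ennreal (setdist {a} B) \<le> pompeiu_hausdorff A B"
proof -
  have "ennreal (setdist {a} B) \<le> excess A B"
    unfolding excess_def using assms by (rule SUP_upper)
  then show ?thesis
    unfolding pompeiu_hausdorff_def by (rule max.coboundedI1)
qed

text \<open>
  The quasi-contraction towards a strict fixed point. Using the same \<open>b\<close> on both sides is what
  allows the \<open>\<gamma>\<close> term to be absorbed.
\<close>

lemma dist_strict_fixed_point_le:
  fixes T :: "'a::metric_space \<Rightarrow> 'a set"
  assumes "\<alpha> \<ge> 0" "\<beta> \<ge> 0" "\<gamma> \<ge> 0" "\<gamma> < 1"
    and contr: "pompeiu_hausdorff (T y) (T z)
      \<le> ennreal (\<alpha> * dist y z + \<beta> * setdist {y} (T z) + \<gamma> * setdist {z} (T y))"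
    and z: "T z = {z}" and b: "b \<in> T y"
  shows "dist b z \<le> (\<alpha> + \<beta>) / (1 - \<gamma>) * dist y z"
proof -
  have "ennreal (dist b z) \<le> pompeiu_hausdorff (T y) (T z)"
    using setdist_le_pompeiu_hausdorff[OF b, of "T z"] by (simp add: z)
  also note contr
  finally have "dist b z \<le> \<alpha> * dist y z + \<beta> * setdist {y} (T z) + \<gamma> * setdist {z} (T y)"
    using assms by (subst (asm) ennreal_le_iff) (simp_all add: setdist_pos_le)
  also have "\<dots> \<le> (\<alpha> + \<beta>) * dist y z + \<gamma> * dist b z"
  proof -
    have "setdist {z} (T y) \<le> dist b z"
      using setdist_le_dist[of z "{z}" b "T y"] b by (simp add: dist_commute)
    then have "\<gamma> * setdist {z} (T y) \<le> \<gamma> * dist b z"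
      using \<open>\<gamma> \<ge> 0\<close> by (rule mult_left_mono)
    then show ?thesis by (simp add: z algebra_simps)
  qed
  finally show ?thesis
    using \<open>\<gamma> < 1\<close> by (simp add: field_simps)
qed

text \<open>
  With \<open>A = {f y}\<close> and \<open>z\<close> a fixed point of \<open>f\<close>, this is the classical bound of the distance to
  the fixed point by the displacement \<open>dist y (f y)\<close>. The infimum
  over \<open>A\<close> need not be attained, so the contraction at a single nearest point would not do.
\<close>

lemma dist_le_setdist_if_quasi_contractive:
  fixes y z :: "'a::metric_space"
  assumes "A \<noteq> {}" "k < 1"
    and quasi: "\<And>b. b \<in> A \<Longrightarrow> dist b z \<le> k * dist y z"
  shows "dist y z \<le> 1 / (1 - k) * setdist {y} A"
proof -
  have "(1 - k) * dist y z \<le> setdist {y} A"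
  proof (rule le_setdistI)
    fix a b assume "a \<in> {y}" "b \<in> A"
    then show "(1 - k) * dist y z \<le> dist a b"
      using dist_triangle[of y z b] quasi[of b] by (simp add: algebra_simps)
  qed (use \<open>A \<noteq> {}\<close> in auto)
  then show ?thesis
    using \<open>k < 1\<close> by (simp add: field_simps)
qed

theorem theorem2p10:
  fixes T :: "'a::complete_space \<Rightarrow> 'a set"
  assumes "\<And>x. T x \<noteq> {}"
    and "SFix T \<noteq> {}"
    and "\<exists>\<alpha> \<beta> \<gamma> :: real. \<alpha> \<ge> 0 \<and> \<beta> \<ge> 0 \<and> \<gamma> \<ge> 0 \<and> \<alpha> + \<beta> + \<gamma> < 1 \<and>
      (\<forall>x y. pompeiu_hausdorff (T x) (T y)
        \<le> ennreal (\<alpha> * dist x y + \<beta> * setdist {x} (T y) + \<gamma> * setdist {y} (T x)))"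
  shows "strict_fp_ulam_hyers_stable T"
proof -
  obtain z where zS: "z \<in> SFix T" and z: "T z = {z}"
    using assms(2) by (auto simp: SFix_def)
  obtain \<alpha> \<beta> \<gamma> :: real where coeffs: "\<alpha> \<ge> 0" "\<beta> \<ge> 0" "\<gamma> \<ge> 0" "\<alpha> + \<beta> + \<gamma> < 1"
    and contr: "\<And>x y. pompeiu_hausdorff (T x) (T y)
      \<le> ennreal (\<alpha> * dist x y + \<beta> * setdist {x} (T y) + \<gamma> * setdist {y} (T x))"
    using assms(3) by blast
  have "\<gamma> < 1" using coeffs by linarith
  define k where "k = (\<alpha> + \<beta>) / (1 - \<gamma>)"
  have "k < 1"
    using coeffs \<open>\<gamma> < 1\<close> by (simp add: k_def field_simps)
  have bound: "dist y z \<le> 1 / (1 - k) * setdist {y} (T y)" for y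
  proof (rule dist_le_setdist_if_quasi_contractive[OF assms(1) \<open>k < 1\<close>])
    fix b assume "b \<in> T y"
    then show "dist b z \<le> k * dist y z"
      unfolding k_def
      by (rule dist_strict_fixed_point_le[OF coeffs(1-3) \<open>\<gamma> < 1\<close> contr[of y z] z])
  qed
  show ?thesis
    unfolding strict_fp_ulam_hyers_stable_def
  proof (intro exI[of _ "1 / (1 - k)"] conjI allI impI)
    show "1 / (1 - k) > 0" using \<open>k < 1\<close> by simp
  next
    fix \<epsilon> y assume "setdist {y} (T y) \<le> \<epsilon>"
    then have "1 / (1 - k) * setdist {y} (T y) \<le> 1 / (1 - k) * \<epsilon>"
      using \<open>k < 1\<close> by (intro mult_left_mono) auto
    then show "\<exists>x\<in>SFix T. dist y x \<le> 1 / (1 - k) * \<epsilon>"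
      using bound[of y] zS by (meson order_trans)
  qed
qed

end
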